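(* Let $k\ge 2$ be an integer, let $X=\{1,\dots,k\}^{\mathbb{Z}}$ and let $T:X\to X$ be the shift map. Let $A_1,\dots,A_k\in GL(2,\mathbb{R})$ and let $\mathcal{A}:X\to GL(2,\mathbb{R})$, $\mathcal{A}((x_l)_l)=A_{x_0}$, be the associated locally constant cocycle. Suppose that $T$ satisfies the Anosov closing property. Let $\Phi=\{\log\phi_n\}_{n=1}^\infty$ with $\phi_n(x)=\|\mathcal{A}_n(x)\|$. Then the maximal Lyapunov exponent $\beta(\Phi)$ can be approximated by Lyapunov exponents of measures supported on periodic orbits: for every $\varepsilon>0$ there exist $p\in X$ and $n\ge1$ with $T^n(p)=p$ such that the $T$-invariant probability measure $\mu_p=\frac1n\sum_{j=0}^{n-1}\delta_{T^j(p)}$ satisfies $|\chi(\mu_p,\Phi)-\beta(\Phi)|<\varepsilon$.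
   Context: The space $X=\{1,\dots,k\}^{\mathbb{Z}}$ carries a metric $d$ inducing the product topology (e.g. the standard one $d(x,y)=2^{-\min\{|l|:x_l\neq y_l\}}$ for $x\ne y$), and the shift is $T((x_l)_l)=(x_{l+1})_l$. For $n\ge1$, $\mathcal{A}_n(x)=\mathcal{A}(T^{n-1}(x))\mathcal{A}(T^{n-2}(x))\cdots\mathcal{A}(x)$, and $\|\cdot\|$ is the operator norm. $\delta_x$ denotes the Dirac measure at $x$. For a $T$-invariant Borel probability measure $\mu$ on $X$, $\chi(\mu,\Phi)=\lim_{n\to\infty}\frac1n\int\log\phi_n\,d\mu$. The maximal Lyapunov exponent is $\beta(\Phi)=\lim_{n\to\infty}\frac1n\log\sup_{x\in X}\phi_n(x)$. A homeomorphism $T$ of a compact metric space $(X,d)$ satisfies the Anosov closing property if there exist $C,\varepsilon_0,\delta>0$ such that for any $x\in X$ and $n\in\mathbb{N}$ with $d(x,T^n(x))<\varepsilon_0$ there is a point $p\in X$ with $T^n(p)=p$ and $d(T^i(x),T^i(p))\le C e^{-\delta\min\{i,n-i\}}\,d(T^n(x),x)$ for every $i=0,\dots,n$. *)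

theory Defs
  imports "HOL-Probability.Probability"
begin

definition full_shift :: "nat \<Rightarrow> (int \<Rightarrow> nat) set" where
  "full_shift k = {x. \<forall>l. x l \<in> {1..k}}"

definition shift :: "(int \<Rightarrow> 'a) \<Rightarrow> (int \<Rightarrow> 'a)" where
  "shift x = (\<lambda>l. x (l + 1))"

definition shift_topology :: "nat \<Rightarrow> (int \<Rightarrow> nat) topology" where
  "shift_topology k = product_topology (\<lambda>_::int. discrete_topology {1..k}) UNIV"

definition borel_sigma :: "'a topology \<Rightarrow> 'a measure" where
  "borel_sigma \<tau> = sigma (topspace \<tau>) {U. openin \<tau> U}"

definition invariant_prob_measure :: "'a topology \<Rightarrow> ('a \<Rightarrow> 'a) \<Rightarrow> 'a measure \<Rightarrow> bool" where
  "invariant_prob_measure \<tau> T \<mu> \<longleftrightarrow>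
     prob_space \<mu> \<and> sets \<mu> = sets (borel_sigma \<tau>) \<and> T \<in> measurable \<mu> \<mu> \<and> distr \<mu> \<mu> T = \<mu>"

text \<open>The property is meant for a homeomorphism of a compact metric space; these standing
  assumptions on \<open>M\<close>, \<open>d\<close> and \<open>T\<close> are not part of the predicate. The case \<open>n = 0\<close> holds
  trivially (take \<open>p = x\<close>).\<close>
definition anosov_closing :: "'a set \<Rightarrow> ('a \<Rightarrow> 'a \<Rightarrow> real) \<Rightarrow> ('a \<Rightarrow> 'a) \<Rightarrow> bool" where
  "anosov_closing M d T \<longleftrightarrow>
     (\<exists>C \<epsilon>\<^sub>0 \<delta>. C > 0 \<and> \<epsilon>\<^sub>0 > 0 \<and> \<delta> > 0 \<and>
        (\<forall>x\<in>M. \<forall>n::nat. d x ((T ^^ n) x) < \<epsilon>\<^sub>0 \<longrightarrow>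
           (\<exists>p\<in>M. (T ^^ n) p = p \<and>
              (\<forall>i\<le>n. d ((T ^^ i) x) ((T ^^ i) p)
                 \<le> C * exp (- \<delta> * real (min i (n - i))) * d ((T ^^ n) x) x))))"

fun cocycle_prod :: "('a \<Rightarrow> 'a) \<Rightarrow> ('a \<Rightarrow> real^2^2) \<Rightarrow> nat \<Rightarrow> 'a \<Rightarrow> real^2^2" where
  "cocycle_prod T B 0 x = mat 1"
| "cocycle_prod T B (Suc n) x = B ((T ^^ n) x) ** cocycle_prod T B n x"

definition cocycle_norm :: "('a \<Rightarrow> 'a) \<Rightarrow> ('a \<Rightarrow> real^2^2) \<Rightarrow> nat \<Rightarrow> 'a \<Rightarrow> real" where
  "cocycle_norm T B n x = onorm ((*v) (cocycle_prod T B n x))"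

text \<open>A potential \<open>\<Phi> = {log \<phi>\<^sub>n}\<close> is given by the sequence \<open>\<phi>\<close>. For an invertible locally
  constant cocycle both limits below exist and are finite, by subadditivity.\<close>
definition lyapunov_exponent :: "'a measure \<Rightarrow> (nat \<Rightarrow> 'a \<Rightarrow> real) \<Rightarrow> real" where
  "lyapunov_exponent \<mu> \<phi> = lim (\<lambda>n. (1 / real n) * (\<integral>x. ln (\<phi> n x) \<partial>\<mu>))"

definition maximal_lyapunov_exponent :: "'a set \<Rightarrow> (nat \<Rightarrow> 'a \<Rightarrow> real) \<Rightarrow> real" where
  "maximal_lyapunov_exponent M \<phi> = lim (\<lambda>n. (1 / real n) * ln (SUP x\<in>M. \<phi> n x))"

text \<open>The measure \<open>\<Sum>\<^sub>j\<^sub><\<^sub>n \<delta>(T\<^sup>j p) / n\<close>; the library writes the Dirac measure as \<^const>\<open>return\<close>.\<close>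
definition orbit_measure :: "'a topology \<Rightarrow> ('a \<Rightarrow> 'a) \<Rightarrow> nat \<Rightarrow> 'a \<Rightarrow> 'a measure" where
  "orbit_measure \<tau> T n p =
     measure_of (topspace \<tau>) (sets (borel_sigma \<tau>))
       (\<lambda>E. ennreal (1 / real n) *
          (\<Sum>j<n. emeasure (return (borel_sigma \<tau>) ((T ^^ j) p)) E))"

lemma topspace_shift_topology: "topspace (shift_topology k) = full_shift k"
  by (auto simp: shift_topology_def full_shift_def PiE_def Pi_def)

lemma space_borel_sigma [simp]: "space (borel_sigma \<tau>) = topspace \<tau>"
  unfolding borel_sigma_def by (rule space_measure_of) (auto dest: openin_subset)

lemma space_orbit_measure [simp]: "space (orbit_measure \<tau> T n p) = topspace \<tau>"
  unfolding orbit_measure_def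
  by (rule space_measure_of) (metis sets.space_closed space_borel_sigma)

lemma sets_orbit_measure [simp]: "sets (orbit_measure \<tau> T n p) = sets (borel_sigma \<tau>)"
  unfolding orbit_measure_def
  by (metis sets.sets_measure_of_eq space_borel_sigma)

lemma emeasure_orbit_measure:
  assumes "E \<in> sets (borel_sigma \<tau>)"
  shows "emeasure (orbit_measure \<tau> T n p) E =
    ennreal (1 / real n) * (\<Sum>j<n. indicator E ((T ^^ j) p))"
proof -
  let ?B = "borel_sigma \<tau>"
  let ?f = "\<lambda>E. ennreal (1 / real n) * (\<Sum>j<n. emeasure (return ?B ((T ^^ j) p)) E)"
  have pos: "positive (sets ?B) ?f"
    by (simp add: positive_def)
  have ca: "countably_additive (sets ?B) ?f"
  proof (rule countably_additiveI)
    fix F :: "nat \<Rightarrow> 'a set"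
    assume F: "range F \<subseteq> sets ?B" "disjoint_family F"
    have "(\<Sum>i. ?f (F i)) = ennreal (1 / real n) *
        (\<Sum>j<n. \<Sum>i. emeasure (return ?B ((T ^^ j) p)) (F i))"
      by (simp only: ennreal_suminf_cmult suminf_sum[OF summableI])
    also have "\<dots> = ?f (\<Union>i. F i)"
      using F by (simp add: suminf_indicator)
    finally show "(\<Sum>i. ?f (F i)) = ?f (\<Union>i. F i)" .
  qed
  have "emeasure (orbit_measure \<tau> T n p) E = ?f E"
    using emeasure_measure_of_sigma[OF _ pos ca assms] sets.sigma_algebra_axioms[of ?B]
    by (simp add: orbit_measure_def)
  then show ?thesis
    using assms by simp
qed

lemma measurable_borel_sigma:
  assumes "continuous_map \<tau> \<tau>' f"
  shows "f \<in> measurable (borel_sigma \<tau>) (borel_sigma \<tau>')"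
  unfolding borel_sigma_def[of \<tau>']
proof (rule measurable_measure_of)
  show "{U. openin \<tau>' U} \<subseteq> Pow (topspace \<tau>')"
    by (auto dest: openin_subset)
  show "f \<in> space (borel_sigma \<tau>) \<rightarrow> topspace \<tau>'"
    using assms by (auto simp: continuous_map_def)
  fix U assume "U \<in> {U. openin \<tau>' U}"
  then have "openin \<tau> {x \<in> topspace \<tau>. f x \<in> U}"
    using assms by (auto simp: continuous_map_def)
  moreover have "f -` U \<inter> space (borel_sigma \<tau>) = {x \<in> topspace \<tau>. f x \<in> U}"
    by auto
  ultimately show "f -` U \<inter> space (borel_sigma \<tau>) \<in> sets (borel_sigma \<tau>)"
    unfolding borel_sigma_def
    by (subst sets_measure_of) (auto dest: openin_subset)
qed

lemma invariant_orbit_measure: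
  assumes T: "continuous_map \<tau> \<tau> T" and p: "p \<in> topspace \<tau>"
    and n: "n \<ge> 1" and per: "(T ^^ n) p = p"
  shows "invariant_prob_measure \<tau> T (orbit_measure \<tau> T n p)"
proof -
  let ?\<mu> = "orbit_measure \<tau> T n p"
  have orb: "(T ^^ j) p \<in> topspace \<tau>" for j
    using T p by (induction j) (auto simp: continuous_map_def)
  have one: "ennreal (1 / real n) * of_nat n = 1"
    using n by (simp add: ennreal_of_nat_eq_real_of_nat flip: ennreal_mult)
  have "emeasure ?\<mu> (space ?\<mu>) = 1"
    using orb one sets.top[of "borel_sigma \<tau>"] by (simp add: emeasure_orbit_measure)
  then have prob: "prob_space ?\<mu>"
    by (rule prob_spaceI)
  have meas: "T \<in> measurable ?\<mu> ?\<mu>"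
    using measurable_borel_sigma[OF T] by (simp cong: measurable_cong_sets)
  have "distr ?\<mu> ?\<mu> T = ?\<mu>"
  proof (rule measure_eqI)
    fix E assume "E \<in> sets (distr ?\<mu> ?\<mu> T)"
    then have E: "E \<in> sets (borel_sigma \<tau>)" by simp
    let ?g = "\<lambda>j. indicator E ((T ^^ j) p) :: ennreal"
    have pre: "T -` E \<inter> topspace \<tau> \<in> sets (borel_sigma \<tau>)"
      using measurable_sets[OF meas, of E] E by simp
    have ind: "indicator (T -` E \<inter> topspace \<tau>) ((T ^^ j) p) = ?g (Suc j)" for j
      using orb[of j] by (simp add: indicator_def)
    obtain m where m: "n = Suc m" using n by (cases n) auto
    have "(\<Sum>j<n. ?g (Suc j)) = (\<Sum>j<m. ?g (Suc j)) + ?g n"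
      by (simp add: m)
    also have "\<dots> = ?g 0 + (\<Sum>j<m. ?g (Suc j))"
      using per by (simp add: add.commute)
    also have "\<dots> = (\<Sum>j<n. ?g j)"
      unfolding m by (rule sum.lessThan_Suc_shift[symmetric])
    finally have rot: "(\<Sum>j<n. ?g (Suc j)) = (\<Sum>j<n. ?g j)" .
    have "emeasure (distr ?\<mu> ?\<mu> T) E = emeasure ?\<mu> (T -` E \<inter> topspace \<tau>)"
      using E by (simp add: emeasure_distr[OF meas])
    then show "emeasure (distr ?\<mu> ?\<mu> T) E = emeasure ?\<mu> E"
      using E pre ind rot by (simp only: emeasure_orbit_measure)
  qed simp
  with prob meas show ?thesis
    by (simp add: invariant_prob_measure_def)
qed

lemma continuous_map_shift: "continuous_map (shift_topology k) (shift_topology k) shift"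
  unfolding shift_topology_def shift_def
  by (auto simp: continuous_map_componentwise_UNIV intro: continuous_map_product_projection)

lemma invariant_orbit_measure_shift:
  assumes "p \<in> full_shift k" "n \<ge> 1" "(shift ^^ n) p = p"
  shows "invariant_prob_measure (shift_topology k) shift
    (orbit_measure (shift_topology k) shift n p)"
  using assms by (intro invariant_orbit_measure continuous_map_shift)
    (auto simp: topspace_shift_topology)

end

theory Submission
  imports Defs
begin

text \<open>Closing a word up to a periodic point is immediate in the full shift, so the theorem is the
  Berger--Wang theorem for \<open>2 \<times> 2\<close> matrices. Eigenvalues are controlled through trace and
  determinant: both \<open>\<bar>trace B\<bar> / 2\<close> and \<open>sqrt \<bar>det B\<bar>\<close> bound the spectral radius of \<open>B\<close> from below.
  If the matrices \<open>A i\<close> have no common eigenvector, no nonzero \<open>B\<close> satisfies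
  \<open>trace B = det B = trace (A i ** B) = 0\<close> for all \<open>i\<close>, so by compactness one of \<open>B\<close>, \<open>A i ** B\<close> has
  spectral radius at least a constant times the norm of \<open>B\<close>. Applied to a long product \<open>B\<close> of almost
  maximal norm, this costs nothing in the exponential growth rate. If there is a common eigenvector,
  the matrices are simultaneously triangular and a fixed point of the shift attains the maximum.\<close>

section \<open>Subadditive sequences\<close>

text \<open>The limit is the infimum of \<open>u n / real n\<close>. With \<open>m\<close> nearly
  attaining it and \<open>n = q * m + r\<close>, subadditivity bounds \<open>u n\<close> by
  \<open>q\<close> copies of \<open>u m\<close> plus a bounded remainder. The linear lower bound
  keeps the infimum finite.\<close>

lemma fekete:
  fixes u :: "nat \<Rightarrow> real"
  assumes sub: "\<And>m n. u (m + n) \<le> u m + u n" and bdd: "\<And>n. c * real n \<le> u n"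
  obtains l where "(\<lambda>n. u n / real n) \<longlonglongrightarrow> l" and "\<And>n. n \<ge> 1 \<Longrightarrow> l \<le> u n / real n"
proof -
  define l where "l = (INF n\<in>{1..}. u n / real n)"
  have "c \<le> u n / real n" if "n \<ge> 1" for n
    using bdd[of n] that by (simp add: field_simps)
  then have below: "bdd_below ((\<lambda>n. u n / real n) ` {1..})"
    by (auto intro!: bdd_belowI2)
  have le: "l \<le> u n / real n" if "n \<ge> 1" for n
    unfolding l_def using that by (intro cINF_lower[OF below]) auto
  have mult: "u (q * m + r) \<le> real q * u m + u r" for q m r
  proof (induction q)
    case (Suc q)
    have "u (m + (q * m + r)) \<le> u m + u (q * m + r)" by (rule sub)
    with Suc show ?case by (simp add: algebra_simps)
  qed simp
  have "(\<lambda>n. u n / real n) \<longlonglongrightarrow> l"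
  proof (rule LIMSEQ_I)
    fix e :: real assume e: "e > 0"
    have "\<exists>m\<in>{1..}. u m / real m < l + e / 2"
      using e below by (subst cINF_less_iff[symmetric]) (auto simp: l_def)
    then obtain m where m: "m \<ge> 1" "u m / real m < l + e / 2" by auto
    \<comment> \<open>\<open>K\<close> bounds, uniformly in \<open>n\<close>, both the remainder
      \<open>u r\<close> and the error of replacing \<open>q\<close> by
      \<open>real n / real m\<close>.\<close>
    define K where "K = \<bar>u m\<bar> + (\<Sum>r<m. \<bar>u r\<bar>)"
    obtain N :: nat where N: "real N > 2 * K / e" using reals_Archimedean2 by blast
    show "\<exists>N. \<forall>n\<ge>N. norm (u n / real n - l) < e"
    proof (intro exI allI impI)
      fix n assume n: "n \<ge> max 1 N"
      define q r where "q = n div m" and "r = n mod m"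
      have nqr: "n = q * m + r" and r: "r < m"
        using m by (auto simp: q_def r_def)
      have ur: "\<bar>u r\<bar> \<le> (\<Sum>r<m. \<bar>u r\<bar>)"
        using r by (intro member_le_sum) auto
      have "real q * u m = (real n - real r) * (u m / real m)"
        using m by (simp add: nqr field_simps)
      also have "\<dots> = real n * (u m / real m) - (real r / real m) * u m"
        by (simp add: left_diff_distrib diff_divide_distrib)
      also have "- ((real r / real m) * u m) \<le> \<bar>u m\<bar>"
      proof -
        have "\<bar>(real r / real m) * u m\<bar> \<le> 1 * \<bar>u m\<bar>"
          unfolding abs_mult using r by (intro mult_right_mono) auto
        then show ?thesis by linarith
      qed
      then have "real n * (u m / real m) - (real r / real m) * u m \<le> real n * (u m / real m) + \<bar>u m\<bar>"
        by linarith
      finally have "u n \<le> real n * (u m / real m) + K"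
        using mult[of q m r] ur unfolding K_def nqr[symmetric] by linarith
      then have "u n / real n \<le> u m / real m + K / real n"
        using n by (simp add: field_simps)
      moreover have "K / real n < e / 2"
      proof -
        have "2 * K / e < real n" using N n by (simp add: less_le_trans)
        then show ?thesis using e n by (simp add: field_simps)
      qed
      ultimately have "u n / real n < l + e" using m by linarith
      moreover have "l \<le> u n / real n" using le n by simp
      ultimately show "norm (u n / real n - l) < e" by (simp add: abs_less_iff)
    qed
  qed
  with le show ?thesis using that by blast
qed

section \<open>Norms, powers and spectral bounds of matrices\<close>

abbreviation mnorm :: "real^'n^'m \<Rightarrow> real" where
  "mnorm B \<equiv> onorm ((*v) B)"

primrec matpow :: "real^'n^'n \<Rightarrow> nat \<Rightarrow> real^'n^'n" where
  "matpow B 0 = mat 1"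
| "matpow B (Suc q) = B ** matpow B q"

lemma mnorm_nonneg: "0 \<le> mnorm B"
  by (rule onorm_pos_le) simp

lemma norm_mult_vec_le: "norm (B *v v) \<le> mnorm B * norm v"
  by (rule onorm) simp

lemma mnorm_mult_le:
  fixes A :: "real^'n^'m" and B :: "real^'p^'n"
  shows "mnorm (A ** B) \<le> mnorm A * mnorm B"
proof -
  have "(*v) (A ** B) = (*v) A \<circ> (*v) B"
    by (simp add: fun_eq_iff matrix_vector_mul_assoc)
  then show ?thesis
    using onorm_compose[of "(*v) A" "(*v) B"] by simp
qed

lemma mnorm_one: "mnorm (mat 1 :: real^'n^'n) = 1"
proof -
  have "(*v) (mat 1 :: real^'n^'n) = (\<lambda>x. x)" by (simp add: fun_eq_iff)
  then show ?thesis using onorm_id[where 'a="real^'n"] by simp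
qed

text \<open>The compactness argument below runs on the unit sphere of the Euclidean norm, while
  cocycles are measured by \<open>mnorm\<close>. The factor 4 counts the entries.\<close>

lemma mnorm_le_norm:
  fixes B :: "real^2^2"
  shows "mnorm B \<le> 4 * norm B"
proof -
  have "\<bar>B $ i $ j\<bar> \<le> norm B" for i j
    using component_le_norm_cart[of "B $ i" j] Finite_Cartesian_Product.norm_nth_le[of B i] by linarith
  from onorm_le_matrix_component[OF this] show ?thesis by simp
qed

lemma abs_det_le_mnorm:
  fixes B :: "real^2^2"
  shows "\<bar>det B\<bar> \<le> 2 * (mnorm B)\<^sup>2"
proof -
  have "\<bar>B $ i $ j * B $ i' $ j'\<bar> \<le> (mnorm B)\<^sup>2" for i j i' j'
    unfolding abs_mult power2_eq_square
    by (intro mult_mono matrix_component_le_onorm) (auto intro: mnorm_nonneg)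
  from this[of 1 1 2 2] this[of 1 2 2 1] show ?thesis
    unfolding det_2 by linarith
qed

section \<open>Growth of the powers of a matrix\<close>

lemma det_matpow: "det (matpow B q) = det B ^ q"
  by (induction q) (auto simp: det_mul)

lemma matpow_eigenvector:
  assumes "B *v v = r *\<^sub>R v"
  shows "matpow B q *v v = r ^ q *\<^sub>R v"
proof (induction q)
  case (Suc q)
  have "matpow B (Suc q) *v v = B *v (matpow B q *v v)"
    by (simp add: matrix_vector_mul_assoc)
  also have "\<dots> = r ^ q *\<^sub>R (B *v v)"
    unfolding Suc by (rule matrix_vector_mult_scaleR)
  finally show ?case using assms by simp
qed simp

text \<open>A real root \<open>r\<close> of the characteristic polynomial has an eigenvector, along
  which the powers grow exactly like \<open>r ^ q\<close>.\<close>

lemma matpow_growth_eigenvalue: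
  fixes B :: "real^2^2"
  assumes "r\<^sup>2 - trace B * r + det B = 0"
  shows "\<bar>r\<bar> ^ q \<le> mnorm (matpow B q)"
proof -
  have "det (B - mat r) = 0"
    using assms by (simp add: det_2 trace_def sum_2 mat_def power2_eq_square algebra_simps)
  then have "\<not> invertible (B - mat r)"
    by (simp add: invertible_det_nz)
  then obtain v where v: "v \<noteq> 0" "(B - mat r) *v v = 0"
    by (auto simp: invertible_left_inverse matrix_left_invertible_ker)
  have "mat r *v v = r *\<^sub>R v"
    by (simp add: vec_eq_iff forall_2 matrix_vector_mult_def mat_def sum_2)
  with v have "B *v v = r *\<^sub>R v"
    by (simp add: matrix_vector_mult_diff_rdistrib)
  then have "matpow B q *v v = r ^ q *\<^sub>R v" by (rule matpow_eigenvector)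
  with norm_mult_vec_le[of "matpow B q" v] v show ?thesis
    by (simp add: power_abs)
qed

text \<open>The determinant is multiplicative and at most twice the squared norm, so its powers
  force growth even when the eigenvalues are not real.\<close>

lemma matpow_growth_det:
  fixes B :: "real^2^2"
  assumes "r\<^sup>2 \<le> \<bar>det B\<bar>" and "r \<ge> 0"
  shows "r ^ q / 2 \<le> mnorm (matpow B q)"
proof (rule power2_le_imp_le)
  have "(r ^ q / 2)\<^sup>2 = (r\<^sup>2) ^ q / 4"
    by (simp add: power_divide flip: power_mult) (simp add: mult.commute)
  also have "\<dots> \<le> \<bar>det B\<bar> ^ q / 2"
  proof -
    have "(r\<^sup>2) ^ q \<le> \<bar>det B\<bar> ^ q" using assms by (intro power_mono) auto
    moreover have "0 \<le> \<bar>det B\<bar> ^ q" by simp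
    ultimately show ?thesis by linarith
  qed
  also have "\<dots> \<le> (mnorm (matpow B q))\<^sup>2"
    using abs_det_le_mnorm[of "matpow B q"] by (simp add: det_matpow power_abs)
  finally show "(r ^ q / 2)\<^sup>2 \<le> (mnorm (matpow B q))\<^sup>2" .
qed (rule mnorm_nonneg)

text \<open>If the discriminant is negative, the determinant exceeds a quarter of the squared trace
  and the determinant bound applies. Otherwise some real eigenvalue has modulus at least
  \<open>\<bar>trace B\<bar> / 2\<close>.\<close>

lemma matpow_growth_trace:
  fixes B :: "real^2^2"
  assumes r: "2 * r \<le> \<bar>trace B\<bar>" "r \<ge> 0"
  shows "r ^ q / 2 \<le> mnorm (matpow B q)"
proof (cases "(trace B)\<^sup>2 < 4 * det B")
  case True
  have "(2 * r)\<^sup>2 \<le> \<bar>trace B\<bar>\<^sup>2" using r by (intro power_mono) auto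
  with True have "r\<^sup>2 \<le> \<bar>det B\<bar>" by (simp add: power_mult_distrib)
  then show ?thesis using r by (intro matpow_growth_det)
next
  case False
  define s where "s = sqrt ((trace B)\<^sup>2 - 4 * det B)"
  have s: "s\<^sup>2 = (trace B)\<^sup>2 - 4 * det B" "s \<ge> 0"
    using False by (auto simp: s_def)
  \<comment> \<open>The sign of the root follows that of the trace, so nothing cancels and
    \<open>\<bar>l\<bar> = (\<bar>trace B\<bar> + s) / 2\<close>.\<close>
  define l where "l = (trace B + (if trace B \<ge> 0 then s else - s)) / 2"
  have "l\<^sup>2 - trace B * l + det B = 0"
    using s(1) by (auto simp: l_def power2_eq_square field_simps)
  then have "\<bar>l\<bar> ^ q \<le> mnorm (matpow B q)" by (rule matpow_growth_eigenvalue)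
  moreover have "r \<le> \<bar>l\<bar>" using r s(2) by (auto simp: l_def)
  then have "r ^ q \<le> \<bar>l\<bar> ^ q" using r by (intro power_mono)
  moreover have "0 \<le> r ^ q" using r by simp
  ultimately show ?thesis by linarith
qed

section \<open>Spectral bounds in the absence of a common eigenvector\<close>

text \<open>Such a \<open>B\<close> is nilpotent of rank one, so it is a product of a column
  \<open>u\<close> and a row \<open>w\<close> with \<open>w\<close> annihilating \<open>u\<close>.
  Then \<open>trace (A i ** B)\<close> is \<open>w\<close> applied to \<open>A i *v u\<close>, and
  its vanishing makes \<open>A i *v u\<close> parallel to \<open>u\<close>. Parallelism is expressed
  by the 2 by 2 determinant of the two vectors.\<close>

lemma common_eigenvector:
  fixes B :: "real^2^2"
  assumes "B \<noteq> 0" "trace B = 0" "det B = 0" and A: "\<And>i. i \<in> I \<Longrightarrow> trace (A i ** B) = 0"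
  obtains u where "u \<noteq> 0" "\<And>i. i \<in> I \<Longrightarrow> u $ 1 * (A i *v u) $ 2 = u $ 2 * (A i *v u) $ 1"
proof -
  define p q r where "p = B $ 1 $ 1" and "q = B $ 1 $ 2" and "r = B $ 2 $ 1"
  have d: "B $ 2 $ 2 = - p"
    using assms(2) by (simp add: trace_def sum_2 p_def)
  have B: "B $ 2 $ 2 = - p" "p * p + q * r = 0"
    using d assms(3) by (simp_all add: det_2 d flip: p_def q_def r_def)
  have nz: "p \<noteq> 0 \<or> q \<noteq> 0 \<or> r \<noteq> 0"
    using assms(1) B(1) by (auto simp: vec_eq_iff forall_2 p_def q_def r_def)
  have tr: "A i $ 1 $ 1 * p + A i $ 1 $ 2 * r + A i $ 2 $ 1 * q - A i $ 2 $ 2 * p = 0" if "i \<in> I" for i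
    using A[OF that] B
    by (simp add: trace_def sum_2 matrix_matrix_mult_def p_def q_def r_def algebra_simps)
  show ?thesis
  \<comment> \<open>The vector \<open>u\<close> spans the image of \<open>B\<close>: it is the first
    column \<open>(p, r)\<close>, or, if that vanishes, a multiple of the second column
    \<open>(q, 0)\<close>.\<close>
  proof (cases "p = 0 \<and> r = 0")
    case True
    with nz B have "q \<noteq> 0" by auto
    with True tr have "A i $ 2 $ 1 = 0" if "i \<in> I" for i using that by fastforce
    then show ?thesis
      by (intro that[of "vector [1, 0]"])
        (auto simp: vec_eq_iff forall_2 matrix_vector_mult_def sum_2)
  next
    case False
    define u :: "real^2" where "u = vector [p, r]"
    have "u $ 1 * (A i *v u) $ 2 = u $ 2 * (A i *v u) $ 1" if "i \<in> I" for i
    proof -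
      have "p * (A i $ 2 $ 1 * p + A i $ 2 $ 2 * r) = r * (A i $ 1 $ 1 * p + A i $ 1 $ 2 * r)"
        using tr[OF that] B(2) by algebra
      then show ?thesis by (simp add: u_def matrix_vector_mult_def sum_2)
    qed
    with False show ?thesis
      by (intro that[of u]) (auto simp: u_def vec_eq_iff forall_2)
  qed
qed

text \<open>The sum \<open>g\<close> of all the quantities involved has no zero on the unit sphere,
  by \<open>common_eigenvector\<close>, hence a positive minimum there. Scaling extends this to
  every \<open>B\<close> with one constant; the determinant is quadratic, which explains the
  squares.\<close>

lemma irreducible_spectral_bound:
  fixes A :: "'i \<Rightarrow> real^2^2"
  assumes I: "finite I"
    and irr: "\<And>u. u \<noteq> 0 \<Longrightarrow> \<exists>i\<in>I. u $ 1 * (A i *v u) $ 2 \<noteq> u $ 2 * (A i *v u) $ 1"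
  obtains c where "c > 0" "\<And>B. c * mnorm B \<le> \<bar>trace B\<bar> \<or> (c * mnorm B)\<^sup>2 \<le> \<bar>det B\<bar> \<or>
    (\<exists>i\<in>I. c * mnorm B \<le> \<bar>trace (A i ** B)\<bar>)"
proof -
  define g where "g B = \<bar>trace B\<bar> + \<bar>det B\<bar> + (\<Sum>i\<in>I. \<bar>trace (A i ** B)\<bar>)" for B :: "real^2^2"
  have "continuous_on (sphere 0 1) g"
    unfolding g_def trace_def det_2 matrix_matrix_mult_def sum_2
    by (simp, intro continuous_intros)
  moreover obtain B1 :: "real^2^2" where "norm B1 = 1" using vector_choose_size[of 1] by auto
  ultimately obtain B0 where B0: "B0 \<in> sphere 0 1" "\<And>B. B \<in> sphere 0 1 \<Longrightarrow> g B0 \<le> g B"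
    using continuous_attains_inf[of "sphere 0 1" g] by fastforce
  have "g B0 \<noteq> 0"
  proof
    assume "g B0 = 0"
    moreover have "0 \<le> (\<Sum>i\<in>I. \<bar>trace (A i ** B0)\<bar>)" by (simp add: sum_nonneg)
    ultimately have td: "trace B0 = 0" "det B0 = 0" and "(\<Sum>i\<in>I. \<bar>trace (A i ** B0)\<bar>) = 0"
      unfolding g_def by linarith+
    then have "trace (A i ** B0) = 0" if "i \<in> I" for i
      using I that by (simp add: sum_nonneg_eq_0_iff)
    moreover have "B0 \<noteq> 0" using B0 by auto
    ultimately obtain u where "u \<noteq> 0" "\<And>i. i \<in> I \<Longrightarrow> u $ 1 * (A i *v u) $ 2 = u $ 2 * (A i *v u) $ 1"
      using common_eigenvector[OF _ td, of I A] by metis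
    with irr show False by blast
  qed
  then have g0: "g B0 > 0"
    by (smt (verit) g_def abs_ge_zero sum_nonneg)
  \<comment> \<open>\<open>g\<close> has \<open>card I + 2\<close> terms, so they cannot all be
    below \<open>\<delta>\<close> on the sphere. The cap at 1 gives
    \<open>\<delta>\<^sup>2 \<le> \<delta>\<close>, needed for the determinant.\<close>
  define \<delta> where "\<delta> = min 1 (g B0 / (real (card I) + 2))"
  have \<delta>: "\<delta> > 0" "\<delta> \<le> 1" "(real (card I) + 2) * \<delta> \<le> g B0"
  proof -
    have "(real (card I) + 2) * \<delta> \<le> (real (card I) + 2) * (g B0 / (real (card I) + 2))"
      unfolding \<delta>_def by (intro mult_left_mono) auto
    also have "\<dots> = g B0" by simp
    finally show "(real (card I) + 2) * \<delta> \<le> g B0" .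
  qed (use g0 in \<open>auto simp: \<delta>_def\<close>)
  \<comment> \<open>The 4 converts \<open>mnorm\<close> into \<open>norm\<close>, by
    \<open>mnorm_le_norm\<close>.\<close>
  have main: "\<delta> / 4 * mnorm B \<le> \<bar>trace B\<bar> \<or> (\<delta> / 4 * mnorm B)\<^sup>2 \<le> \<bar>det B\<bar> \<or>
      (\<exists>i\<in>I. \<delta> / 4 * mnorm B \<le> \<bar>trace (A i ** B)\<bar>)" for B
  proof (rule ccontr)
    assume neg: "\<not> ?thesis"
    define t where "t = norm B"
    have B: "B \<noteq> 0"
      using neg mnorm_le_norm[of B] mnorm_nonneg[of B] by auto
    then have t: "t > 0" by (simp add: t_def)
    define s where "s = \<delta> / 4 * mnorm B"
    have s: "0 \<le> s" "s \<le> \<delta> * t"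
      using mnorm_le_norm[of B] \<delta>(1) mnorm_nonneg[of B] by (auto simp: s_def t_def)
    let ?B = "(1 / t) *\<^sub>R B"
    have 1: "\<bar>trace ?B\<bar> < \<delta>"
    proof -
      have eq: "trace ?B = trace B / t" by (simp add: trace_def sum_2 add_divide_distrib)
      have "\<bar>trace B\<bar> < \<delta> * t" using neg s by (auto simp: s_def)
      then show ?thesis using t by (simp add: eq pos_divide_less_eq)
    qed
    have 2: "\<bar>det ?B\<bar> < \<delta>"
    proof -
      have eq: "det ?B = det B / t\<^sup>2" by (simp add: det_2 power2_eq_square diff_divide_distrib)
      have "\<bar>det B\<bar> < (\<delta> * t)\<^sup>2"
        using neg power_mono[OF s(2,1), of 2] by (auto simp: s_def)
      also have "(\<delta> * t)\<^sup>2 \<le> \<delta> * t\<^sup>2"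
        using \<delta> t by (simp add: power2_eq_square)
      finally show ?thesis using t by (simp add: eq pos_divide_less_eq)
    qed
    have 3: "\<bar>trace (A i ** ?B)\<bar> \<le> \<delta>" if "i \<in> I" for i
    proof -
      have eq: "trace (A i ** ?B) = trace (A i ** B) / t"
        by (simp add: trace_def sum_2 matrix_matrix_mult_def add_divide_distrib)
      have "\<bar>trace (A i ** B)\<bar> < \<delta> * t" using neg s that by (auto simp: s_def)
      then show ?thesis using t by (simp add: eq pos_divide_le_eq)
    qed
    have "(\<Sum>i\<in>I. \<bar>trace (A i ** ?B)\<bar>) \<le> real (card I) * \<delta>"
      using 3 by (rule sum_bounded_above)
    with 1 2 have "g ?B < (real (card I) + 2) * \<delta>"
      by (simp add: g_def algebra_simps)
    moreover have "?B \<in> sphere 0 1" using t by (simp add: t_def)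
    ultimately show False using B0(2) \<delta>(3) by fastforce
  qed
  show ?thesis using \<delta>(1) main by (intro that[of "\<delta> / 4"]) auto
qed

lemma matrix_inv_left_inverse:
  assumes "invertible B"
  shows "matrix_inv B ** B = mat 1"
  using assms unfolding matrix_inv_def invertible_def by (rule someI2_ex) simp

section \<open>Periodic orbits\<close>

text \<open>Moving the window by one step drops its first term and appends one that equals it by
  periodicity.\<close>

lemma sum_periodic_orbit:
  fixes f :: "'a \<Rightarrow> real"
  assumes "(T ^^ n) p = p"
  shows "(\<Sum>j<n. f ((T ^^ (j + m)) p)) = (\<Sum>j<n. f ((T ^^ j) p))"
proof (induction m)
  case (Suc m)
  define g where "g j = f ((T ^^ (j + m)) p)" for j
  have "(T ^^ (n + m)) p = (T ^^ m) p"
    using assms by (subst add.commute) (simp add: funpow_add)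
  then have "g n = g 0" by (simp add: g_def)
  moreover have "g 0 + (\<Sum>j<n. g (Suc j)) = (\<Sum>j<n. g j) + g n"
    by (subst sum.lessThan_Suc_shift[symmetric]) simp
  ultimately have "(\<Sum>j<n. g (Suc j)) = (\<Sum>j<n. g j)"
    by linarith
  with Suc show ?case by (simp add: g_def)
qed simp

text \<open>The orbit measure is the image of the uniform measure on \<open>{..<n}\<close> under the
  map sending \<open>j\<close> to \<open>(T ^^ j) p\<close>; repeated points count with
  multiplicity.\<close>

lemma integral_orbit_measure:
  fixes f :: "'a \<Rightarrow> real"
  assumes orb: "\<And>j. (T ^^ j) p \<in> topspace \<tau>" and n: "n \<ge> 1"
    and f: "f \<in> borel_measurable (borel_sigma \<tau>)"
  shows "(\<integral>x. f x \<partial>orbit_measure \<tau> T n p) = (\<Sum>j<n. f ((T ^^ j) p)) / real n"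
proof -
  let ?U = "uniform_count_measure {..<n}"
  have g: "(\<lambda>j. (T ^^ j) p) \<in> measurable ?U (borel_sigma \<tau>)"
    using orb by (auto simp: measurable_def sets_uniform_count_measure space_uniform_count_measure)
  have "orbit_measure \<tau> T n p = distr ?U (borel_sigma \<tau>) (\<lambda>j. (T ^^ j) p)"
  proof (rule measure_eqI)
    fix E assume "E \<in> sets (orbit_measure \<tau> T n p)"
    then have E: "E \<in> sets (borel_sigma \<tau>)" by simp
    have "emeasure (distr ?U (borel_sigma \<tau>) (\<lambda>j. (T ^^ j) p)) E
        = ennreal (real (card ({..<n} \<inter> {j. (T ^^ j) p \<in> E})) / real n)"
      using E by (subst emeasure_distr[OF g])
        (auto simp: emeasure_uniform_count_measure space_uniform_count_measure
          intro!: arg_cong[where f=card])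
    also have "\<dots> = ennreal (1 / real n) * of_nat (card ({..<n} \<inter> {j. (T ^^ j) p \<in> E}))"
      by (simp add: ennreal_of_nat_eq_real_of_nat flip: ennreal_mult)
    also have "of_nat (card ({..<n} \<inter> {j. (T ^^ j) p \<in> E})) = (\<Sum>j<n. indicator E ((T ^^ j) p) :: ennreal)"
      by (simp add: indicator_def sum.If_cases)
    finally show "emeasure (orbit_measure \<tau> T n p) E
        = emeasure (distr ?U (borel_sigma \<tau>) (\<lambda>j. (T ^^ j) p)) E"
      using E by (simp add: emeasure_orbit_measure)
  qed simp
  then show ?thesis
    by (simp add: integral_distr[OF g f] integral_uniform_count_measure)
qed

section \<open>Measurability and periodic points in the full shift\<close>

lemma sets_borel_sigma_openin: "openin \<tau> U \<Longrightarrow> U \<in> sets (borel_sigma \<tau>)"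
  unfolding borel_sigma_def by (subst sets_measure_of) (auto dest: openin_subset)

text \<open>Such an \<open>f\<close> is locally constant, so its preimages are unions of cylinders
  and therefore open. \<open>C x\<close> is the cylinder of sequences agreeing with \<open>x\<close>
  on \<open>L\<close>.\<close>

lemma borel_measurable_finite_coordinates:
  fixes f :: "(int \<Rightarrow> nat) \<Rightarrow> real"
  assumes L: "finite L" and f: "\<And>x y. (\<And>l. l \<in> L \<Longrightarrow> x l = y l) \<Longrightarrow> f x = f y"
  shows "f \<in> borel_measurable (borel_sigma (shift_topology k))"
proof (rule borel_measurableI)
  fix S :: "real set"
  define C where "C x = Pi\<^sub>E UNIV (\<lambda>l. if l \<in> L then {x l} else {1..k})" for x :: "int \<Rightarrow> nat"
  have C: "openin (shift_topology k) (C x)" if "x \<in> full_shift k" for x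
    unfolding C_def shift_topology_def
  proof (rule openin_PiE_gen[THEN iffD2], intro disjI2 conjI ballI)
    show "finite {l \<in> UNIV. (if l \<in> L then {x l} else {1..k}) \<noteq> topspace (discrete_topology {1..k})}"
      by (rule finite_subset[OF _ L]) auto
  qed (use that in \<open>auto simp: full_shift_def\<close>)
  have "openin (shift_topology k) (f -` S \<inter> full_shift k)"
  proof (subst openin_subopen, intro ballI exI conjI)
    fix x assume x: "x \<in> f -` S \<inter> full_shift k"
    show "openin (shift_topology k) (C x)" using x C by auto
    show "x \<in> C x" using x by (auto simp: C_def full_shift_def)
    show "C x \<subseteq> f -` S \<inter> full_shift k"
    proof
      fix y assume y: "y \<in> C x"
      have "f y = f x" by (rule f) (use y in \<open>auto simp: C_def PiE_iff split: if_splits\<close>)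
      moreover have "y \<in> full_shift k"
        using openin_subset[OF C[of x]] x y by (auto simp: topspace_shift_topology)
      ultimately show "y \<in> f -` S \<inter> full_shift k" using x by auto
    qed
  qed
  then show "f -` S \<inter> space (borel_sigma (shift_topology k)) \<in> sets (borel_sigma (shift_topology k))"
    by (simp add: topspace_shift_topology sets_borel_sigma_openin)
qed

lemma shift_funpow: "(shift ^^ n) x = (\<lambda>l. x (l + int n))"
  by (induction n) (auto simp: shift_def add_ac)

lemma shift_funpow_in_full_shift: "x \<in> full_shift k \<Longrightarrow> (shift ^^ n) x \<in> full_shift k"
  by (auto simp: shift_funpow full_shift_def)

text \<open>The word \<open>w\<close> is repeated in both directions; on \<open>int\<close>,
  \<open>mod\<close> by a positive number is nonnegative even at negative positions.\<close>

lemma periodic_extension: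
  assumes "n \<ge> 1" and w: "\<And>j. j < n \<Longrightarrow> w j \<in> {1..k}"
  obtains p where "p \<in> full_shift k" "(shift ^^ n) p = p" "\<And>j. j < n \<Longrightarrow> p (int j) = w j"
proof
  let ?p = "\<lambda>l. w (nat (l mod int n))"
  have "nat (l mod int n) < n" for l
    using assms(1) by (simp add: nat_less_iff)
  then show "?p \<in> full_shift k" using w unfolding full_shift_def by blast
  show "(shift ^^ n) ?p = ?p" by (simp add: shift_funpow)
  show "?p (int j) = w j" if "j < n" for j using that by simp
qed

section \<open>Lyapunov exponents of locally constant cocycles\<close>

locale shift_cocycle =
  fixes k :: nat and A :: "nat \<Rightarrow> real^2^2"
  assumes k: "k \<ge> 1" and GL2: "\<And>i. i \<in> {1..k} \<Longrightarrow> invertible (A i)"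
begin

abbreviation X where "X \<equiv> full_shift k"
abbreviation cprod where "cprod \<equiv> cocycle_prod shift (\<lambda>x. A (x 0))"
abbreviation \<phi> where "\<phi> \<equiv> cocycle_norm shift (\<lambda>x. A (x 0))"
abbreviation \<beta> where "\<beta> \<equiv> maximal_lyapunov_exponent X \<phi>"
abbreviation \<gamma> where "\<gamma> p n \<equiv> lyapunov_exponent (orbit_measure (shift_topology k) shift n p) \<phi>"

lemma X_nonempty: "X \<noteq> {}"
  using k by (auto simp: full_shift_def intro!: exI[of _ "\<lambda>_. 1"])

lemma symbol: "x \<in> X \<Longrightarrow> x l \<in> {1..k}"
  unfolding full_shift_def by blast

lemma cprod_Suc: "cprod (Suc n) x = A (x (int n)) ** cprod n x"
  by (simp add: shift_funpow)

lemma cprod_add: "cprod (m + n) x = cprod m ((shift ^^ n) x) ** cprod n x"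
  by (induction m) (auto simp: shift_funpow matrix_mul_assoc add_ac)

lemma cprod_cong: "(\<And>j. j < n \<Longrightarrow> x (int j) = y (int j)) \<Longrightarrow> cprod n x = cprod n y"
  by (induction n) (auto simp: shift_funpow)

text \<open>This turns the growth of the cocycle along a periodic orbit into the growth of powers of
  one matrix.\<close>

lemma cprod_periodic:
  assumes "(shift ^^ n) p = p"
  shows "cprod (q * n) p = matpow (cprod n p) q"
proof (induction q)
  case (Suc q)
  have "(shift ^^ (q * n)) p = p"
    using assms by (induction q) (auto simp: funpow_add)
  then show ?case using Suc cprod_add[of n "q * n" p] by simp
qed simp

lemma \<phi>_add_le: "\<phi> (m + n) x \<le> \<phi> m ((shift ^^ n) x) * \<phi> n x"
  unfolding cocycle_norm_def cprod_add by (rule mnorm_mult_le)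

section \<open>Uniform exponential bounds\<close>

text \<open>One constant dominating the generators and their inverses; the summand 1 makes
  \<open>K \<ge> 1\<close>, so that \<open>ln K\<close> is nonnegative and powers of
  \<open>K\<close> increase.\<close>

definition K where "K = 1 + (\<Sum>i=1..k. mnorm (A i) + mnorm (matrix_inv (A i)))"

lemma K_bounds:
  assumes "i \<in> {1..k}"
  shows "mnorm (A i) \<le> K" "mnorm (matrix_inv (A i)) \<le> K"
proof -
  have "mnorm (A i) + mnorm (matrix_inv (A i)) \<le> (\<Sum>i=1..k. mnorm (A i) + mnorm (matrix_inv (A i)))"
    using assms by (intro member_le_sum) (auto intro!: add_nonneg_nonneg mnorm_nonneg)
  moreover have "0 \<le> mnorm (A i)" "0 \<le> mnorm (matrix_inv (A i))" by (rule mnorm_nonneg)+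
  ultimately show "mnorm (A i) \<le> K" "mnorm (matrix_inv (A i)) \<le> K"
    unfolding K_def by linarith+
qed

lemma K_ge_1: "K \<ge> 1"
  unfolding K_def by (simp add: sum_nonneg mnorm_nonneg)

lemma \<phi>_nonneg: "0 \<le> \<phi> n x"
  unfolding cocycle_norm_def by (rule mnorm_nonneg)

lemma \<phi>_0: "\<phi> 0 x = 1"
  unfolding cocycle_norm_def by (simp add: mnorm_one)

lemma \<phi>_Suc_le:
  assumes "x \<in> X"
  shows "\<phi> (Suc n) x \<le> K * \<phi> n x"
proof -
  have "\<phi> (Suc n) x \<le> mnorm (A (x (int n))) * \<phi> n x"
    unfolding cocycle_norm_def cprod_Suc by (rule mnorm_mult_le)
  also have "\<dots> \<le> K * \<phi> n x"
    using K_bounds(1)[OF symbol[OF assms]] \<phi>_nonneg by (rule mult_right_mono)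
  finally show ?thesis .
qed

text \<open>The last factor is undone by its inverse. Iterating this bounds \<open>\<phi>\<close>
  away from 0, so its logarithms are genuine and decrease at most linearly.\<close>

lemma \<phi>_le_Suc:
  assumes "x \<in> X"
  shows "\<phi> n x \<le> K * \<phi> (Suc n) x"
proof -
  let ?A = "A (x (int n))"
  have "cprod n x = matrix_inv ?A ** cprod (Suc n) x"
    unfolding cprod_Suc matrix_mul_assoc
    using matrix_inv_left_inverse[OF GL2[OF symbol[OF assms]]] by simp
  then have "\<phi> n x \<le> mnorm (matrix_inv ?A) * \<phi> (Suc n) x"
    unfolding cocycle_norm_def by (metis mnorm_mult_le)
  also have "\<dots> \<le> K * \<phi> (Suc n) x"
    using K_bounds(2)[OF symbol[OF assms]] \<phi>_nonneg by (rule mult_right_mono)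
  finally show ?thesis .
qed

lemma \<phi>_upper: "x \<in> X \<Longrightarrow> \<phi> n x \<le> K ^ n"
proof (induction n)
  case (Suc n)
  have "K * \<phi> n x \<le> K * K ^ n" using Suc K_ge_1 by (intro mult_left_mono) auto
  with \<phi>_Suc_le[of x n] Suc show ?case by simp
qed (simp add: \<phi>_0)

lemma \<phi>_lower: "x \<in> X \<Longrightarrow> 1 / K ^ n \<le> \<phi> n x"
proof (induction n)
  case (Suc n)
  then have "1 / K ^ n \<le> K * \<phi> (Suc n) x" using \<phi>_le_Suc[of x n] by simp
  then show ?case using K_ge_1 by (simp add: field_simps)
qed (simp add: \<phi>_0)

lemma \<phi>_pos: "x \<in> X \<Longrightarrow> 0 < \<phi> n x"
  using K_ge_1 by (intro less_le_trans[OF _ \<phi>_lower]) auto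

lemma ln_\<phi>_lower: "x \<in> X \<Longrightarrow> - ln K * real n \<le> ln (\<phi> n x)"
proof -
  assume x: "x \<in> X"
  have "ln (1 / K ^ n) \<le> ln (\<phi> n x)"
    using \<phi>_lower[OF x] \<phi>_pos[OF x] K_ge_1 by (subst ln_le_cancel_iff) auto
  then show ?thesis using K_ge_1 by (simp add: ln_div ln_realpow mult.commute)
qed

section \<open>The maximal exponent\<close>

lemma bdd_above_\<phi>: "bdd_above (\<phi> n ` X)"
  using \<phi>_upper by (intro bdd_aboveI2)

lemma \<phi>_le_Sup: "x \<in> X \<Longrightarrow> \<phi> n x \<le> (SUP x\<in>X. \<phi> n x)"
  using bdd_above_\<phi> by (intro cSUP_upper)

lemma Sup_pos: "0 < (SUP x\<in>X. \<phi> n x)"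
proof -
  obtain x where x: "x \<in> X" using X_nonempty by auto
  show ?thesis by (rule less_le_trans[OF \<phi>_pos[OF x] \<phi>_le_Sup[OF x]])
qed

text \<open>Fekete's lemma applies to the logarithm of the supremum. It shows that the
  \<open>lim\<close> defining \<open>\<beta>\<close> exists and is an infimum, which yields the
  second claim.\<close>

lemma maximal_exponent_limit:
  "(\<lambda>n. ln (SUP x\<in>X. \<phi> n x) / real n) \<longlonglongrightarrow> \<beta>"
  "n \<ge> 1 \<Longrightarrow> \<beta> \<le> ln (SUP x\<in>X. \<phi> n x) / real n"
proof -
  let ?s = "\<lambda>n. SUP x\<in>X. \<phi> n x"
  have sub: "ln (?s (m + n)) \<le> ln (?s m) + ln (?s n)" for m n
  proof -
    have "?s (m + n) \<le> ?s m * ?s n"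
    proof (rule cSUP_least[OF X_nonempty])
      fix x assume x: "x \<in> X"
      have "\<phi> m ((shift ^^ n) x) * \<phi> n x \<le> ?s m * ?s n"
        using x Sup_pos[of m]
        by (intro mult_mono \<phi>_le_Sup shift_funpow_in_full_shift \<phi>_nonneg) auto
      with \<phi>_add_le[of m n x] show "\<phi> (m + n) x \<le> ?s m * ?s n" by linarith
    qed
    then have "ln (?s (m + n)) \<le> ln (?s m * ?s n)"
      using Sup_pos by (subst ln_le_cancel_iff) auto
    then show ?thesis using Sup_pos by (simp add: ln_mult_pos)
  qed
  have bdd: "- ln K * real n \<le> ln (?s n)" for n
  proof -
    obtain x where x: "x \<in> X" using X_nonempty by auto
    have "ln (\<phi> n x) \<le> ln (?s n)"
      using \<phi>_pos[OF x] \<phi>_le_Sup[OF x] Sup_pos by (subst ln_le_cancel_iff) auto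
    with ln_\<phi>_lower[OF x, of n] show ?thesis by linarith
  qed
  obtain l where l: "(\<lambda>n. ln (?s n) / real n) \<longlonglongrightarrow> l" "\<And>n. n \<ge> 1 \<Longrightarrow> l \<le> ln (?s n) / real n"
    using fekete[OF sub bdd] by blast
  have "\<beta> = l"
    unfolding maximal_lyapunov_exponent_def using l(1) by (intro limI) simp
  with l show "(\<lambda>n. ln (?s n) / real n) \<longlonglongrightarrow> \<beta>" "n \<ge> 1 \<Longrightarrow> \<beta> \<le> ln (?s n) / real n"
    by auto
qed

text \<open>The supremum is at least \<open>exp (real n * \<beta>)\<close>; halving makes the
  inequality strict, so some point realizes it.\<close>

lemma maximal_exponent_witness:
  assumes "n \<ge> 1"
  obtains x where "x \<in> X" "exp (real n * \<beta>) / 2 < \<phi> n x"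
proof -
  have "real n * \<beta> \<le> ln (SUP x\<in>X. \<phi> n x)"
    using maximal_exponent_limit(2)[OF assms] assms by (simp add: field_simps)
  then have "exp (real n * \<beta>) \<le> (SUP x\<in>X. \<phi> n x)"
    using Sup_pos by (simp add: ln_ge_iff)
  then have "exp (real n * \<beta>) / 2 < (SUP x\<in>X. \<phi> n x)"
    using exp_gt_zero[of "real n * \<beta>"] by linarith
  then show ?thesis
    using that by (auto simp: less_cSUP_iff[OF X_nonempty bdd_above_\<phi>])
qed

text \<open>The constant \<open>C\<close> contributes \<open>ln C / real n\<close>, which tends to
  0.\<close>

lemma maximal_exponent_le:
  assumes C: "C > 0" and s: "s > 0" and le: "\<And>n x. x \<in> X \<Longrightarrow> \<phi> n x \<le> C * s ^ n"
  shows "\<beta> \<le> ln s"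
proof (rule LIMSEQ_le[OF maximal_exponent_limit(1)])
  have "(\<lambda>n. ln C * (1 / real n) + ln s) \<longlonglongrightarrow> ln C * 0 + ln s"
    by (rule tendsto_add[OF tendsto_mult[OF tendsto_const lim_1_over_n] tendsto_const])
  then show "(\<lambda>n. ln C * (1 / real n) + ln s) \<longlonglongrightarrow> ln s" by simp
  have "ln (SUP x\<in>X. \<phi> n x) / real n \<le> ln C * (1 / real n) + ln s" if "n \<ge> 1" for n
  proof -
    have "(SUP x\<in>X. \<phi> n x) \<le> C * s ^ n"
      using le by (intro cSUP_least X_nonempty)
    then have "ln (SUP x\<in>X. \<phi> n x) \<le> ln (C * s ^ n)"
      using Sup_pos C s by (subst ln_le_cancel_iff) auto
    then show ?thesis using C s that by (simp add: ln_mult ln_realpow field_simps)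
  qed
  then show "\<exists>N. \<forall>n\<ge>N. ln (SUP x\<in>X. \<phi> n x) / real n \<le> ln C * (1 / real n) + ln s"
    by blast
qed

section \<open>Exponents of periodic orbits\<close>

text \<open>For \<open>p\<close> in \<open>X\<close> and \<open>n \<ge> 1\<close> this is the
  integral of \<open>ln (\<phi> m x)\<close> against the orbit measure, as a finite sum.\<close>

definition avg where "avg p n m = (\<Sum>j<n. ln (\<phi> m ((shift ^^ j) p))) / real n"

text \<open>The averages are subadditive in \<open>m\<close>, because the orbit sum is invariant
  under the shift, so Fekete's lemma gives convergence.\<close>

lemma periodic_exponent_limit:
  assumes p: "p \<in> X" "(shift ^^ n) p = p" and n: "n \<ge> 1"
  shows "(\<lambda>m. avg p n m / real m) \<longlonglongrightarrow> \<gamma> p n"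
proof -
  have orb: "(shift ^^ j) p \<in> X" for j by (rule shift_funpow_in_full_shift[OF p(1)])
  have sub: "avg p n (l + m) \<le> avg p n l + avg p n m" for l m
  proof -
    have "ln (\<phi> (l + m) ((shift ^^ j) p)) \<le>
        ln (\<phi> l ((shift ^^ (j + m)) p)) + ln (\<phi> m ((shift ^^ j) p))" for j
    proof -
      have "\<phi> (l + m) ((shift ^^ j) p) \<le> \<phi> l ((shift ^^ (j + m)) p) * \<phi> m ((shift ^^ j) p)"
        using \<phi>_add_le[of l m "(shift ^^ j) p"]
        by (simp add: funpow_add add.commute[of j m])
      then have "ln (\<phi> (l + m) ((shift ^^ j) p)) \<le>
          ln (\<phi> l ((shift ^^ (j + m)) p) * \<phi> m ((shift ^^ j) p))"
        by (intro ln_mono \<phi>_pos orb)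
      then show ?thesis by (simp add: ln_mult_pos \<phi>_pos orb)
    qed
    then have "(\<Sum>j<n. ln (\<phi> (l + m) ((shift ^^ j) p))) \<le>
        (\<Sum>j<n. ln (\<phi> l ((shift ^^ (j + m)) p)) + ln (\<phi> m ((shift ^^ j) p)))"
      by (intro sum_mono)
    also have "\<dots> = (\<Sum>j<n. ln (\<phi> l ((shift ^^ j) p))) + (\<Sum>j<n. ln (\<phi> m ((shift ^^ j) p)))"
      using sum_periodic_orbit[OF p(2), of "\<lambda>x. ln (\<phi> l x)" m] by (simp add: sum.distrib)
    finally show ?thesis
      unfolding avg_def add_divide_distrib[symmetric] by (rule divide_right_mono) simp
  qed
  have bdd: "- ln K * real m \<le> avg p n m" for m
  proof -
    have "(\<Sum>j<n. - ln K * real m) \<le> (\<Sum>j<n. ln (\<phi> m ((shift ^^ j) p)))"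
      by (intro sum_mono ln_\<phi>_lower orb)
    then show ?thesis using n by (simp add: avg_def field_simps)
  qed
  obtain l where l: "(\<lambda>m. avg p n m / real m) \<longlonglongrightarrow> l"
    using fekete[OF sub bdd] by blast
  have "(\<integral>x. ln (\<phi> m x) \<partial>orbit_measure (shift_topology k) shift n p) = avg p n m" for m
    unfolding avg_def
  proof (rule integral_orbit_measure[OF _ n])
    show "(\<lambda>x. ln (\<phi> m x)) \<in> borel_measurable (borel_sigma (shift_topology k))"
    \<comment> \<open>\<open>cprod m\<close> reads only the coordinates 0 to
      \<open>m - 1\<close>.\<close>
    proof (rule borel_measurable_finite_coordinates[of "int ` {..<m}"])
      fix x y :: "int \<Rightarrow> nat" assume "\<And>l. l \<in> int ` {..<m} \<Longrightarrow> x l = y l"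
      then have "cprod m x = cprod m y" by (intro cprod_cong) auto
      then show "ln (\<phi> m x) = ln (\<phi> m y)" by (simp add: cocycle_norm_def)
    qed simp
  qed (simp add: orb topspace_shift_topology)
  then have "\<gamma> p n = l"
    unfolding lyapunov_exponent_def using l by (intro limI) simp
  with l show ?thesis by simp
qed

lemma periodic_exponent_le_maximal:
  assumes p: "p \<in> X" "(shift ^^ n) p = p" and n: "n \<ge> 1"
  shows "\<gamma> p n \<le> \<beta>"
proof (rule LIMSEQ_le[OF periodic_exponent_limit[OF assms] maximal_exponent_limit(1)], intro exI allI impI)
  fix m :: nat
  have "ln (\<phi> m ((shift ^^ j) p)) \<le> ln (SUP x\<in>X. \<phi> m x)" for j
    by (intro ln_mono \<phi>_pos \<phi>_le_Sup shift_funpow_in_full_shift p(1))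
  then have "(\<Sum>j<n. ln (\<phi> m ((shift ^^ j) p))) \<le> (\<Sum>j<n. ln (SUP x\<in>X. \<phi> m x))"
    by (intro sum_mono)
  then have "avg p n m \<le> ln (SUP x\<in>X. \<phi> m x)"
    using n by (simp add: avg_def field_simps)
  then show "avg p n m / real m \<le> ln (SUP x\<in>X. \<phi> m x) / real m"
    by (rule divide_right_mono) simp
qed

text \<open>Passing from \<open>x\<close> to \<open>shift x\<close> removes the first factor and
  appends a last one; each change costs at most \<open>K\<close>.\<close>

lemma \<phi>_shift_lower:
  assumes "x \<in> X"
  shows "\<phi> m x \<le> K\<^sup>2 * \<phi> m (shift x)"
proof -
  have "\<phi> (m + 1) x \<le> \<phi> m (shift x) * \<phi> 1 x"
    using \<phi>_add_le[of m 1 x] by simp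
  also have "\<dots> \<le> \<phi> m (shift x) * K"
    using \<phi>_upper[OF assms, of 1] \<phi>_nonneg by (intro mult_left_mono) auto
  finally have "K * \<phi> (Suc m) x \<le> K * (\<phi> m (shift x) * K)"
    using K_ge_1 by (intro mult_left_mono) auto
  with \<phi>_le_Suc[OF assms, of m] show ?thesis by (simp add: power2_eq_square mult_ac)
qed

lemma \<phi>_orbit_lower:
  assumes "x \<in> X"
  shows "\<phi> m x \<le> (K\<^sup>2) ^ j * \<phi> m ((shift ^^ j) x)"
proof (induction j)
  case (Suc j)
  have "(K\<^sup>2) ^ j * \<phi> m ((shift ^^ j) x) \<le> (K\<^sup>2) ^ j * (K\<^sup>2 * \<phi> m (shift ((shift ^^ j) x)))"
    using assms by (intro mult_left_mono \<phi>_shift_lower shift_funpow_in_full_shift) auto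
  with Suc show ?case by (simp add: mult_ac)
qed simp

text \<open>The growth of the powers is known at \<open>p\<close> only.
  \<open>\<phi>_orbit_lower\<close> carries it to the other orbit points with a loss independent of
  \<open>q\<close>, which disappears in the limit.\<close>

lemma periodic_exponent_lower:
  assumes p: "p \<in> X" "(shift ^^ n) p = p" and n: "n \<ge> 1"
    and r: "r > 0" and c: "c > 0" and growth: "\<And>q. c * r ^ q \<le> mnorm (matpow (cprod n p) q)"
  shows "ln r / real n \<le> \<gamma> p n"
proof -
  \<comment> \<open>The division pays for moving the starting point along fewer than
    \<open>n\<close> steps.\<close>
  define c' where "c' = c / (K\<^sup>2) ^ n"
  have c': "c' > 0" using c K_ge_1 by (simp add: c'_def)
  \<comment> \<open>Since the full limit exists, it may be evaluated along multiples of the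
    period.\<close>
  have subseq_q: "filterlim (\<lambda>q::nat. q * n) sequentially sequentially"
    using n by (intro filterlim_subseq strict_monoI) simp
  have lim1: "(\<lambda>q. avg p n (q * n) / real (q * n)) \<longlonglongrightarrow> \<gamma> p n"
    using filterlim_compose[OF periodic_exponent_limit[OF p n] subseq_q] .
  have "(\<lambda>q. ln c' / real n * (1 / real q) + ln r / real n) \<longlonglongrightarrow> ln c' / real n * 0 + ln r / real n"
    by (rule tendsto_add[OF tendsto_mult[OF tendsto_const lim_1_over_n] tendsto_const])
  then have lim2: "(\<lambda>q. ln c' / real n * (1 / real q) + ln r / real n) \<longlonglongrightarrow> ln r / real n" by simp
  have "ln c' / real n * (1 / real q) + ln r / real n \<le> avg p n (q * n) / real (q * n)" if "q \<ge> 1" for q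
  proof -
    have "ln c' + real q * ln r \<le> ln (\<phi> (q * n) ((shift ^^ j) p))" if "j < n" for j
    proof -
      have "c * r ^ q \<le> \<phi> (q * n) p"
        using growth[of q] p(2) by (simp add: cocycle_norm_def cprod_periodic)
      also have "\<dots> \<le> (K\<^sup>2) ^ j * \<phi> (q * n) ((shift ^^ j) p)"
        by (rule \<phi>_orbit_lower[OF p(1)])
      also have "\<dots> \<le> (K\<^sup>2) ^ n * \<phi> (q * n) ((shift ^^ j) p)"
        using K_ge_1 that by (intro mult_right_mono power_increasing \<phi>_nonneg) auto
      finally have "c' * r ^ q \<le> \<phi> (q * n) ((shift ^^ j) p)"
        using K_ge_1 by (simp add: c'_def field_simps)
      then have "ln (c' * r ^ q) \<le> ln (\<phi> (q * n) ((shift ^^ j) p))"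
        using c' r by (intro ln_mono) auto
      then show ?thesis using c' r by (simp add: ln_mult_pos ln_realpow)
    qed
    then have "(\<Sum>j<n. ln c' + real q * ln r) \<le> (\<Sum>j<n. ln (\<phi> (q * n) ((shift ^^ j) p)))"
      by (intro sum_mono) auto
    then have "ln c' + real q * ln r \<le> avg p n (q * n)"
      using n by (simp add: avg_def field_simps)
    then have "(ln c' + real q * ln r) / real (q * n) \<le> avg p n (q * n) / real (q * n)"
      by (rule divide_right_mono) simp
    moreover have "(ln c' + real q * ln r) / real (q * n) = ln c' / real n * (1 / real q) + ln r / real n"
      using that by (simp add: add_divide_distrib mult.commute)
    ultimately show ?thesis by simp
  qed
  then show ?thesis by (intro LIMSEQ_le[OF lim2 lim1]) blast
qed

section \<open>Approximation by periodic orbits\<close>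

text \<open>With an orthonormal basis \<open>e, e'\<close> whose first vector spans the invariant line, every \<open>A i\<close> is
  upper triangular. In the norm \<open>\<eta> * \<bar>e \<bullet> v\<bar> + \<bar>e' \<bullet> v\<bar>\<close> the off-diagonal entry costs at most \<open>\<eta> * K\<close>,
  so letting \<open>\<eta>\<close> tend to 0 leaves only the largest diagonal entry.\<close>
lemma reducible_bound:
  fixes u :: "real^2"
  assumes "u \<noteq> 0" and inv: "\<And>i. i \<in> {1..k} \<Longrightarrow> u $ 1 * (A i *v u) $ 2 = u $ 2 * (A i *v u) $ 1"
  obtains i r where "i \<in> {1..k}" "r\<^sup>2 - trace (A i) * r + det (A i) = 0" "\<beta> \<le> ln \<bar>r\<bar>"
proof -
  define e where "e = (1 / norm u) *\<^sub>R u"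
  \<comment> \<open>\<open>e'\<close> is \<open>e\<close> turned by a right angle, so the invariance
    of the line reads \<open>e' \<bullet> (A i *v e) = 0\<close>. The diagonal entries in this basis
    are \<open>a i\<close> and \<open>d i\<close> below.\<close>
  define e' :: "real^2" where "e' = vector [- e $ 2, e $ 1]"
  have e: "norm e = 1" using assms(1) by (simp add: e_def)
  have ee: "e $ 1 * e $ 1 + e $ 2 * e $ 2 = 1"
    using e by (simp add: norm_eq_1 inner_vec_def sum_2)
  have e': "norm e' = 1" using ee by (simp add: norm_eq_1 inner_vec_def sum_2 e'_def)
  have inv_e: "e $ 1 * (A i *v e) $ 2 = e $ 2 * (A i *v e) $ 1" if "i \<in> {1..k}" for i
    using inv[OF that] by (simp add: e_def matrix_vector_mult_scaleR)
  have basis: "v = (e \<bullet> v) *\<^sub>R e + (e' \<bullet> v) *\<^sub>R e'" for v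
  proof -
    have "v $ 1 = (e $ 1 * v $ 1 + e $ 2 * v $ 2) * e $ 1 + (- e $ 2 * v $ 1 + e $ 1 * v $ 2) * (- e $ 2)"
      "v $ 2 = (e $ 1 * v $ 1 + e $ 2 * v $ 2) * e $ 2 + (- e $ 2 * v $ 1 + e $ 1 * v $ 2) * e $ 1"
      using ee by algebra+
    then show ?thesis by (simp add: vec_eq_iff forall_2 inner_vec_def sum_2 e'_def)
  qed
  define a where "a i = e \<bullet> (A i *v e)" for i
  define d where "d i = e' \<bullet> (A i *v e')" for i
  have inner_zero: "e' \<bullet> (A i *v e) = 0" if "i \<in> {1..k}" for i
    using inv_e[OF that] by (simp add: inner_vec_def sum_2 e'_def)
  have ad: "trace (A i) = a i + d i" "det (A i) = a i * d i" if "i \<in> {1..k}" for i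
  proof -
    have *: "e $ 1 * (A i $ 2 $ 1 * e $ 1 + A i $ 2 $ 2 * e $ 2) = e $ 2 * (A i $ 1 $ 1 * e $ 1 + A i $ 1 $ 2 * e $ 2)"
      using inv_e[OF that] by (simp add: matrix_vector_mult_def sum_2)
    have a: "a i = e $ 1 * (A i $ 1 $ 1 * e $ 1 + A i $ 1 $ 2 * e $ 2) + e $ 2 * (A i $ 2 $ 1 * e $ 1 + A i $ 2 $ 2 * e $ 2)"
      by (simp add: a_def matrix_vector_mult_def sum_2 inner_vec_def)
    have d: "d i = - e $ 2 * (- A i $ 1 $ 1 * e $ 2 + A i $ 1 $ 2 * e $ 1) + e $ 1 * (- A i $ 2 $ 1 * e $ 2 + A i $ 2 $ 2 * e $ 1)"
      by (simp add: d_def e'_def matrix_vector_mult_def sum_2 inner_vec_def)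
    show tr: "trace (A i) = a i + d i"
      unfolding a d trace_def sum_2 using ee by algebra
    show "det (A i) = a i * d i"
      unfolding a d det_2 using ee * by algebra
  qed
  define M where "M = Max ((\<lambda>i. max \<bar>a i\<bar> \<bar>d i\<bar>) ` {1..k})"
  have "M \<in> (\<lambda>i. max \<bar>a i\<bar> \<bar>d i\<bar>) ` {1..k}"
    unfolding M_def using k by (intro Max_in) auto
  then obtain i0 where i0: "i0 \<in> {1..k}" "M = max \<bar>a i0\<bar> \<bar>d i0\<bar>" by auto
  \<comment> \<open>The dominant diagonal entry of a triangular matrix, hence one of its
    eigenvalues.\<close>
  define r where "r = (if \<bar>a i0\<bar> \<ge> \<bar>d i0\<bar> then a i0 else d i0)"
  have rM: "\<bar>r\<bar> = M" using i0(2) by (auto simp: r_def)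
  have root: "r\<^sup>2 - trace (A i0) * r + det (A i0) = 0"
    using ad[OF i0(1)] by (auto simp: r_def power2_eq_square algebra_simps)
  have M: "\<bar>a i\<bar> \<le> M" "\<bar>d i\<bar> \<le> M" if "i \<in> {1..k}" for i
  proof -
    have "max \<bar>a i\<bar> \<bar>d i\<bar> \<le> M" unfolding M_def using that by (intro Max_ge) auto
    then show "\<bar>a i\<bar> \<le> M" "\<bar>d i\<bar> \<le> M" by auto
  qed
  have Mpos: "M > 0"
  proof -
    have "det (A i0) \<noteq> 0" using GL2[OF i0(1)] by (simp add: invertible_det_nz)
    then have "a i0 \<noteq> 0" using ad(2)[OF i0(1)] by auto
    then show ?thesis using M(1)[OF i0(1)] by linarith
  qed
  have bound: "\<beta> \<le> ln (M + \<eta> * K)" if \<eta>: "\<eta> > 0" for \<eta>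
  proof -
    define N where "N v = \<eta> * \<bar>e \<bullet> v\<bar> + \<bar>e' \<bullet> v\<bar>" for v
    define s where "s = M + \<eta> * K"
    have s: "s > 0" using Mpos \<eta> K_ge_1 by (simp add: s_def add_pos_pos)
    have step: "N (A i *v v) \<le> s * N v" if i: "i \<in> {1..k}" for i v
    proof -
      have Av: "A i *v v = (e \<bullet> v) *\<^sub>R (A i *v e) + (e' \<bullet> v) *\<^sub>R (A i *v e')"
        by (subst basis[of v]) (simp add: matrix_vector_right_distrib matrix_vector_mult_scaleR)
      have "\<bar>e \<bullet> (A i *v e')\<bar> \<le> norm e * norm (A i *v e')"
        by (rule Cauchy_Schwarz_ineq2)
      also have "\<dots> \<le> K"
        using norm_mult_vec_le[of "A i" e'] K_bounds(1)[OF i] e e' by simp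
      finally have off: "\<bar>e \<bullet> (A i *v e')\<bar> \<le> K" .
      have "e \<bullet> (A i *v v) = (e \<bullet> v) * a i + (e' \<bullet> v) * (e \<bullet> (A i *v e'))"
        by (subst Av) (simp add: inner_add_right a_def)
      then have "\<bar>e \<bullet> (A i *v v)\<bar> \<le> \<bar>e \<bullet> v\<bar> * \<bar>a i\<bar> + \<bar>e' \<bullet> v\<bar> * \<bar>e \<bullet> (A i *v e')\<bar>"
        by (metis abs_mult abs_triangle_ineq)
      also have "\<dots> \<le> \<bar>e \<bullet> v\<bar> * M + \<bar>e' \<bullet> v\<bar> * K"
        using M(1)[OF i] off by (intro add_mono mult_left_mono) auto
      finally have 1: "\<eta> * \<bar>e \<bullet> (A i *v v)\<bar> \<le> \<eta> * (\<bar>e \<bullet> v\<bar> * M + \<bar>e' \<bullet> v\<bar> * K)"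
        using \<eta> by simp
      have "e' \<bullet> (A i *v v) = (e' \<bullet> v) * d i"
        by (subst Av) (simp add: inner_add_right d_def inner_zero[OF i])
      then have 2: "\<bar>e' \<bullet> (A i *v v)\<bar> \<le> \<bar>e' \<bullet> v\<bar> * M"
        using M(2)[OF i] by (simp add: abs_mult mult_left_mono)
      have "N (A i *v v) \<le> \<eta> * (\<bar>e \<bullet> v\<bar> * M + \<bar>e' \<bullet> v\<bar> * K) + \<bar>e' \<bullet> v\<bar> * M"
        unfolding N_def using 1 2 by linarith
      also have "\<dots> = s * N v - \<eta> * K * (\<eta> * \<bar>e \<bullet> v\<bar>)"
        by (simp add: s_def N_def algebra_simps)
      also have "\<dots> \<le> s * N v" using \<eta> K_ge_1 by simp
      finally show ?thesis .
    qed
    have iter: "N (cprod n x *v v) \<le> s ^ n * N v" if x: "x \<in> X" for n x v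
    proof (induction n)
      case (Suc n)
      have "N (cprod (Suc n) x *v v) = N (A (x (int n)) *v (cprod n x *v v))"
        unfolding cprod_Suc by (simp only: matrix_vector_mul_assoc)
      also have "\<dots> \<le> s * N (cprod n x *v v)" by (rule step[OF symbol[OF x]])
      also have "\<dots> \<le> s * (s ^ n * N v)" using Suc s by (intro mult_left_mono) auto
      finally show ?case by (simp add: mult_ac)
    qed simp
    \<comment> \<open>\<open>N\<close> is equivalent to the Euclidean norm, with constants depending
      on \<open>\<eta>\<close> but not on \<open>n\<close>; they do not affect the exponential
      rate.\<close>
    define c where "c = min \<eta> 1"
    have c: "c > 0" "c \<le> \<eta>" "c \<le> 1" using \<eta> by (auto simp: c_def)
    have lower: "c * norm v \<le> N v" for v
    proof -
      have "norm v \<le> \<bar>e \<bullet> v\<bar> + \<bar>e' \<bullet> v\<bar>"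
        using norm_triangle_ineq[of "(e \<bullet> v) *\<^sub>R e" "(e' \<bullet> v) *\<^sub>R e'"] basis[of v] e e' by simp
      then have "c * norm v \<le> c * \<bar>e \<bullet> v\<bar> + c * \<bar>e' \<bullet> v\<bar>"
        using c by (simp flip: distrib_left)
      also have "\<dots> \<le> \<eta> * \<bar>e \<bullet> v\<bar> + 1 * \<bar>e' \<bullet> v\<bar>"
        using c by (intro add_mono mult_right_mono) auto
      finally show ?thesis by (simp add: N_def)
    qed
    have upper: "N v \<le> (\<eta> + 1) * norm v" for v
    proof -
      have "\<bar>e \<bullet> v\<bar> \<le> norm v" "\<bar>e' \<bullet> v\<bar> \<le> norm v"
        using Cauchy_Schwarz_ineq2[of e v] Cauchy_Schwarz_ineq2[of e' v] e e' by auto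
      then have "\<eta> * \<bar>e \<bullet> v\<bar> + \<bar>e' \<bullet> v\<bar> \<le> \<eta> * norm v + norm v"
        using \<eta> by (intro add_mono mult_left_mono) auto
      then show ?thesis by (simp add: N_def algebra_simps)
    qed
    have "\<beta> \<le> ln s"
    proof (rule maximal_exponent_le)
      show "(\<eta> + 1) / c > 0" using c \<eta> by simp
      fix n x assume x: "x \<in> X"
      show "\<phi> n x \<le> (\<eta> + 1) / c * s ^ n"
        unfolding cocycle_norm_def
      proof (rule onorm_le)
        fix v
        have "c * norm (cprod n x *v v) \<le> s ^ n * N v"
          using lower iter[OF x] order_trans by blast
        also have "\<dots> \<le> s ^ n * ((\<eta> + 1) * norm v)"
          using upper s by (intro mult_left_mono) auto
        finally show "norm (cprod n x *v v) \<le> (\<eta> + 1) / c * s ^ n * norm v"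
          using c by (simp add: field_simps)
      qed
    qed (rule s)
    then show ?thesis by (simp add: s_def)
  qed
  \<comment> \<open>\<open>\<beta>\<close> does not depend on \<open>\<eta>\<close>, so the bound
    passes to the limit from the right.\<close>
  have "((\<lambda>\<eta>. ln (M + \<eta> * K)) \<longlongrightarrow> ln (M + 0 * K)) (at_right 0)"
    using Mpos by (intro tendsto_intros) auto
  then have "\<beta> \<le> ln (M + 0 * K)"
    by (rule tendsto_lowerbound) (auto simp: eventually_at_right_less bound intro: eventually_mono[OF eventually_at_right_less])
  with root i0(1) rM show ?thesis using that by simp
qed

text \<open>This is the hard inequality. The period is 1 if there is a common eigenvector; otherwise
  it is \<open>n\<close> or \<open>n + 1\<close>, with \<open>n\<close> so large that all constant
  losses fit into \<open>\<epsilon>\<close>.\<close>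

lemma periodic_exponent_approx:
  assumes "\<epsilon> > 0"
  obtains p n where "p \<in> X" "n \<ge> 1" "(shift ^^ n) p = p" "\<beta> - \<epsilon> < \<gamma> p n"
proof (cases "\<exists>u::real^2. u \<noteq> 0 \<and> (\<forall>i\<in>{1..k}. u $ 1 * (A i *v u) $ 2 = u $ 2 * (A i *v u) $ 1)")
  case True
  then obtain u :: "real^2" where "u \<noteq> 0" "\<And>i. i \<in> {1..k} \<Longrightarrow> u $ 1 * (A i *v u) $ 2 = u $ 2 * (A i *v u) $ 1"
    by blast
  then obtain i r where i: "i \<in> {1..k}" and r: "r\<^sup>2 - trace (A i) * r + det (A i) = 0" "\<beta> \<le> ln \<bar>r\<bar>"
    by (rule reducible_bound) blast
  have "det (A i) \<noteq> 0" using GL2[OF i] by (simp add: invertible_det_nz)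
  with r(1) have "r \<noteq> 0" by auto
  obtain p where p: "p \<in> X" "(shift ^^ 1) p = p" "p (int 0) = i"
    using periodic_extension[of 1 "\<lambda>_. i" k] i by auto
  have "ln \<bar>r\<bar> / real 1 \<le> \<gamma> p 1"
  proof (rule periodic_exponent_lower[OF p(1,2), where c = 1])
    show "1 * \<bar>r\<bar> ^ q \<le> mnorm (matpow (cprod 1 p) q)" for q
      using matpow_growth_eigenvalue[OF r(1), of q] p(3) by simp
  qed (use \<open>r \<noteq> 0\<close> in auto)
  with r(2) assms p show ?thesis by (intro that[of p 1]) auto
next
  case False
  note result = that
  from False obtain c where c: "c > 0" and dich: "\<And>B. c * mnorm B \<le> \<bar>trace B\<bar> \<or> (c * mnorm B)\<^sup>2 \<le> \<bar>det B\<bar> \<or>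
    (\<exists>i\<in>{1..k}. c * mnorm B \<le> \<bar>trace (A i ** B)\<bar>)"
    using irreducible_spectral_bound[of "{1..k}" A] by (metis finite_atLeastAtMost)
  \<comment> \<open>The logarithm of the total loss: \<open>c\<close> from the spectral bound, one
    half from the witness \<open>x\<close>, one half from the definition of
    \<open>r\<close>.\<close>
  define L where "L = ln (c / 4)"
  \<comment> \<open>\<open>\<bar>L\<bar>\<close> covers that loss, and
    \<open>\<bar>\<beta>\<bar>\<close> covers a possible extra letter in the period.\<close>
  obtain n :: nat where n: "real n > (\<bar>L\<bar> + \<bar>\<beta>\<bar>) / \<epsilon>" using reals_Archimedean2 by blast
  then have n': "n \<ge> 1" "\<bar>L\<bar> + \<bar>\<beta>\<bar> < \<epsilon> * real n"
    using assms by (auto simp: field_simps Suc_le_eq intro!: gr0I)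
  obtain x where x: "x \<in> X" "exp (real n * \<beta>) / 2 < \<phi> n x"
    using maximal_exponent_witness[OF n'(1)] by blast
  define r where "r = c * \<phi> n x / 2"
  have r: "r > 0" using c \<phi>_pos[OF x(1)] by (simp add: r_def)
  have "c / 4 * exp (real n * \<beta>) \<le> r" using x(2) c by (simp add: r_def)
  then have "ln (c / 4 * exp (real n * \<beta>)) \<le> ln r" using c by (intro ln_mono) auto
  then have lnr: "L + real n * \<beta> \<le> ln r"
    using c ln_mult_pos[of "c / 4" "exp (real n * \<beta>)"] by (simp add: L_def)
  \<comment> \<open>The three alternatives share this ending. Growth is required of every
    \<open>p\<close> that begins with the word \<open>w\<close>, as the product depends only on
    these letters.\<close>
  have close: thesis
    if w: "\<And>j. j < m \<Longrightarrow> w j \<in> {1..k}" and m: "m = n \<or> m = Suc n"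
      and growth: "\<And>p q. (\<And>j. j < m \<Longrightarrow> p (int j) = w j) \<Longrightarrow> r ^ q / 2 \<le> mnorm (matpow (cprod m p) q)"
    for m w
  proof -
    have m1: "m \<ge> 1" using m n' by auto
    obtain p where p: "p \<in> X" "(shift ^^ m) p = p" "\<And>j. j < m \<Longrightarrow> p (int j) = w j"
      using periodic_extension[of m w k, OF m1 w] by blast
    have lower: "ln r / real m \<le> \<gamma> p m"
      by (rule periodic_exponent_lower[OF p(1,2) m1 r, where c = "1 / 2"]) (use growth[OF p(3)] in auto)
    have "real m * (\<beta> - \<epsilon>) < L + real n * \<beta>"
    proof -
      have "real m * \<beta> \<le> real n * \<beta> + \<bar>\<beta>\<bar>" using m by (auto simp: algebra_simps)
      moreover have "\<epsilon> * real n \<le> \<epsilon> * real m" using m assms by auto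
      ultimately show ?thesis using n'(2) by (simp add: algebra_simps)
    qed
    with lnr have "\<beta> - \<epsilon> < ln r / real m" using m1 by (simp add: field_simps)
    with lower have "\<beta> - \<epsilon> < \<gamma> p m" by linarith
    with p m1 show thesis by (intro result[of p m])
  qed
  show thesis
    using dich[of "cprod n x"]
  proof (elim disjE bexE)
    assume "c * mnorm (cprod n x) \<le> \<bar>trace (cprod n x)\<bar>"
    then have tr: "2 * r \<le> \<bar>trace (cprod n x)\<bar>" by (simp add: r_def cocycle_norm_def)
    show thesis
    proof (rule close[of n "\<lambda>j. x (int j)"])
      fix p q assume "\<And>j. j < n \<Longrightarrow> p (int j) = x (int j)"
      then have "cprod n p = cprod n x" by (rule cprod_cong)
      then show "r ^ q / 2 \<le> mnorm (matpow (cprod n p) q)"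
        using matpow_growth_trace[OF tr, of q] r by simp
    qed (use symbol[OF x(1)] in auto)
  next
    assume "(c * mnorm (cprod n x))\<^sup>2 \<le> \<bar>det (cprod n x)\<bar>"
    moreover have "r\<^sup>2 \<le> (c * mnorm (cprod n x))\<^sup>2"
      using r by (intro power_mono) (auto simp: r_def cocycle_norm_def)
    ultimately have det: "r\<^sup>2 \<le> \<bar>det (cprod n x)\<bar>" by linarith
    show thesis
    proof (rule close[of n "\<lambda>j. x (int j)"])
      fix p q assume "\<And>j. j < n \<Longrightarrow> p (int j) = x (int j)"
      then have "cprod n p = cprod n x" by (rule cprod_cong)
      then show "r ^ q / 2 \<le> mnorm (matpow (cprod n p) q)"
        using matpow_growth_det[OF det, of q] r by simp
    qed (use symbol[OF x(1)] in auto)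
  next
    fix i assume i: "i \<in> {1..k}" and "c * mnorm (cprod n x) \<le> \<bar>trace (A i ** cprod n x)\<bar>"
    then have tr: "2 * r \<le> \<bar>trace (A i ** cprod n x)\<bar>" by (simp add: r_def cocycle_norm_def)
    show thesis
    \<comment> \<open>The appended letter \<open>i\<close> sits at position \<open>n\<close>, so
      \<open>A i\<close> becomes the leftmost factor of the product.\<close>
    proof (rule close[of "Suc n" "\<lambda>j. if j < n then x (int j) else i"])
      fix p q assume p: "\<And>j. j < Suc n \<Longrightarrow> p (int j) = (if j < n then x (int j) else i)"
      have "cprod n p = cprod n x" using p by (intro cprod_cong) auto
      moreover have "p (int n) = i" using p[of n] by simp
      ultimately have "cprod (Suc n) p = A i ** cprod n x" by (simp only: cprod_Suc)
      then show "r ^ q / 2 \<le> mnorm (matpow (cprod (Suc n) p) q)"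
        using matpow_growth_trace[OF tr, of q] r by simp
    qed (use symbol[OF x(1)] i in auto)
  qed
qed

end

theorem theorem1p3:
  fixes k :: nat
    and d :: "(int \<Rightarrow> nat) \<Rightarrow> (int \<Rightarrow> nat) \<Rightarrow> real"
    and A :: "nat \<Rightarrow> real^2^2"
    and \<A> :: "(int \<Rightarrow> nat) \<Rightarrow> real^2^2"
    and \<phi> :: "nat \<Rightarrow> (int \<Rightarrow> nat) \<Rightarrow> real"
  assumes k: "k \<ge> 2"
    and metric: "Metric_space (full_shift k) d"
    and topology: "Metric_space.mtopology (full_shift k) d = shift_topology k"
    and GL2: "\<And>i. i \<in> {1..k} \<Longrightarrow> invertible (A i)"
    and closing: "anosov_closing (full_shift k) d shift"
  defines "\<A> \<equiv> \<lambda>x. A (x 0)"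
    and "\<phi> \<equiv> cocycle_norm shift \<A>"
  shows "\<forall>\<epsilon>>0. \<exists>p\<in>full_shift k. \<exists>n\<ge>1. (shift ^^ n) p = p \<and>
    \<bar>lyapunov_exponent (orbit_measure (shift_topology k) shift n p) \<phi>
      - maximal_lyapunov_exponent (full_shift k) \<phi>\<bar> < \<epsilon>"
proof (intro allI impI)
  fix \<epsilon> :: real assume \<epsilon>: "\<epsilon> > 0"
  interpret shift_cocycle k A
    using k GL2 by unfold_locales auto
  \<comment> \<open>The approximation from below and the bound by the maximum confine the difference
    to the interval from \<open>-\<epsilon>\<close> to 0, open at
    \<open>-\<epsilon>\<close>.\<close>
  obtain p n where p: "p \<in> full_shift k" "n \<ge> 1" "(shift ^^ n) p = p"
    and "maximal_lyapunov_exponent (full_shift k) \<phi> - \<epsilon>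
      < lyapunov_exponent (orbit_measure (shift_topology k) shift n p) \<phi>"
    using periodic_exponent_approx[OF \<epsilon>] unfolding \<phi>_def \<A>_def by blast
  moreover have "lyapunov_exponent (orbit_measure (shift_topology k) shift n p) \<phi>
      \<le> maximal_lyapunov_exponent (full_shift k) \<phi>"
    using periodic_exponent_le_maximal[OF p(1,3,2)] unfolding \<phi>_def \<A>_def .
  ultimately show "\<exists>p\<in>full_shift k. \<exists>n\<ge>1. (shift ^^ n) p = p \<and>
    \<bar>lyapunov_exponent (orbit_measure (shift_topology k) shift n p) \<phi>
      - maximal_lyapunov_exponent (full_shift k) \<phi>\<bar> < \<epsilon>"
    using p \<epsilon> by (intro bexI[of _ p] exI[of _ n]) auto
qed

end
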